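(* Let $T\ge 2$ and $n\ge 1$ be integers, let $0\le m_i\le n$ be integers for $1\le i\le T$, and let $0\le t\le T$. Let $x_t$ be the number of elements overlapped exactly $t$ times when independent uniformly random subsets $M_1,\dots,M_T$ of sizes $m_1,\dots,m_T$ are drawn from an $n$-element set. Then $$E(x_t)=\sum_{\substack{S\subseteq\{1,\dots,T\}\\ |S|=t}} E\big(x_T\mid n, M(S)\big)=\sum_{\substack{S\subseteq\{1,\dots,T\}\\ |S|=t}}\frac{\prod_{i\in S} m_i\ \prod_{i\notin S}(n-m_i)}{n^{T-1}},$$ where $M(S)=(m_1^S,\dots,m_T^S)$ with $m_i^S=m_i$ for $i\in S$ and $m_i^S=n-m_i$ for $i\notin S$. In particular, if $m_i=m_0$ for all $1\le i\le T$, then $$E(x_t)=\binom{T}{t}\,\frac{(n-m_0)^{T-t}\,m_0^{t}}{n^{T-1}}.$$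
   Context: General hypergeometric distribution: let $N$ be a finite set with $n$ elements. Choose subsets $M_1,\dots,M_T$ of $N$ independently, $M_i$ being uniformly distributed among all $\binom{n}{m_i}$ subsets of $N$ of size $m_i$. The random variable $x_t$ is the number of elements of $N$ that belong to exactly $t$ of the sets $M_1,\dots,M_T$; in particular $x_T$ is the number of elements belonging to all of them. For a list of sizes $(a_1,\dots,a_T)$ with $0\le a_i\le n$, $E(x_T\mid n,(a_1,\dots,a_T))$ denotes the expectation of $x_T$ when the random subsets have sizes $a_1,\dots,a_T$ instead. Empty products equal $1$. *)

theory Defs
  imports "HOL-Probability.Probability"
begin

text \<open>
  The joint law of the independent random sets $M_1, \dots, M_T$: each $M_i$ is uniform on
  the subsets of $N$ of size $a_i$ (a nonempty finite family as soon as $N$ is finite and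
  $a_i \le |N|$). Families are functions on \<^typ>\<open>nat\<close>; outside the index set
  $\{1, \dots, T\}$ they take the default value \<^term>\<open>{}\<close>, which plays no role.
\<close>

definition random_subsets :: "'a set \<Rightarrow> nat \<Rightarrow> (nat \<Rightarrow> nat) \<Rightarrow> (nat \<Rightarrow> 'a set) pmf" where
  "random_subsets N T a = Pi_pmf {1..T} {} (\<lambda>i. pmf_of_set {A. A \<subseteq> N \<and> card A = a i})"

definition overlap_count :: "'a set \<Rightarrow> nat \<Rightarrow> nat \<Rightarrow> (nat \<Rightarrow> 'a set) \<Rightarrow> nat" where
  "overlap_count N T t M = card {x \<in> N. card {i \<in> {1..T}. x \<in> M i} = t}"

text \<open>
  The expectation $E(x_t \mid n, (a_1, \dots, a_T))$, where $n = |N|$.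
\<close>

definition expected_overlap :: "'a set \<Rightarrow> nat \<Rightarrow> (nat \<Rightarrow> nat) \<Rightarrow> nat \<Rightarrow> real" where
  "expected_overlap N T a t =
     measure_pmf.expectation (random_subsets N T a) (\<lambda>M. real (overlap_count N T t M))"

text \<open>
  The list of sizes $M(S)$. The truncated subtraction is exact whenever $m_i \le n$.
\<close>

definition switched_sizes :: "nat \<Rightarrow> (nat \<Rightarrow> nat) \<Rightarrow> nat set \<Rightarrow> nat \<Rightarrow> nat" where
  "switched_sizes n m S i = (if i \<in> S then m i else n - m i)"

end

theory Submission
  imports Defs
begin

text \<open>
  The reason is linearity of expectation together with independence. An element \<open>x\<close> of \<open>N\<close> is
  overlapped exactly \<open>t\<close> times iff the set of indices \<open>i\<close> with \<open>x \<in> M\<^sub>i\<close> is some \<open>t\<close>-element set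
  \<open>S\<close>, and these events are disjoint for different \<open>S\<close>. For a fixed \<open>S\<close> the event is an
  intersection of \<open>T\<close> independent ones (\<open>x \<in> M\<^sub>i\<close> for \<open>i \<in> S\<close> and \<open>x \<notin> M\<^sub>i\<close> for \<open>i \<notin> S\<close>), whose
  probabilities are \<open>m\<^sub>i / n\<close> and \<open>(n - m\<^sub>i) / n\<close> (lemmas \<open>prob_random_subset_contains\<close> and
  \<open>prob_random_subset_avoids\<close>), regardless of \<open>x\<close>. Summing over the \<open>n\<close> elements
  cancels one of the \<open>T\<close> factors \<open>1 / n\<close>, and the explicit formula \<open>expected_overlap_eq\<close> results.

  For \<open>t = T\<close> the only admissible index set is the full one, so \<open>E(x\<^sub>T)\<close> is the product of
  the sizes over \<open>n\<^bsup>T-1\<^esup>\<close>. With the sizes \<open>M(S)\<close> that product is exactly the summand belonging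
  to \<open>S\<close> in the formula for \<open>E(x\<^sub>t)\<close>, which gives the middle expression.
\<close>

text \<open>
  The \<open>k\<close>-subsets avoiding \<open>x\<close> are the \<open>k\<close>-subsets of \<open>N - {x}\<close>, and
  \<open>n * (n - 1 choose k) = (n - k) * (n choose k)\<close>.
\<close>
lemma prob_random_subset_avoids:
  fixes N :: "'a set"
  assumes "finite N" "x \<in> N" "k \<le> card N"
  shows "measure_pmf.prob (pmf_of_set {A. A \<subseteq> N \<and> card A = k}) {A. x \<notin> A}
           = (real (card N) - real k) / real (card N)"
proof -
  let ?F = "{A. A \<subseteq> N \<and> card A = k}"
  have card_F: "card ?F = card N choose k"
    using assms by (simp add: n_subsets)
  have pos: "card N choose k > 0"
    using assms by simp
  have fin: "finite ?F"
    using assms by simp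
  have ne: "?F \<noteq> {}"
    using card_F pos by (metis card.empty less_numeral_extra(3))
  have "?F \<inter> {A. x \<notin> A} = {A. A \<subseteq> N - {x} \<and> card A = k}"
    by auto
  then have card_avoid: "card (?F \<inter> {A. x \<notin> A}) = (card N - 1) choose k"
    using assms by (simp add: n_subsets)
  have "(card N - k) * (card N choose k) = card N * ((card N - 1) choose k)"
    by (rule binomial_absorb_comp)
  then have "(real (card N) - real k) * real (card N choose k)
               = real (card N) * real ((card N - 1) choose k)"
    using assms(3) by (metis of_nat_diff of_nat_mult)
  moreover have "card N > 0"
    using assms card_gt_0_iff by blast
  ultimately show ?thesis
    using pos by (simp add: measure_pmf_of_set[OF ne fin] card_F card_avoid field_simps)
qed

lemma prob_random_subset_contains:
  fixes N :: "'a set"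
  assumes "finite N" "x \<in> N" "k \<le> card N"
  shows "measure_pmf.prob (pmf_of_set {A. A \<subseteq> N \<and> card A = k}) {A. x \<in> A}
           = real k / real (card N)"
proof -
  let ?p = "pmf_of_set {A. A \<subseteq> N \<and> card A = k}"
  have "{A. x \<in> A} = space (measure_pmf ?p) - {A. x \<notin> A}"
    by auto
  then have "measure_pmf.prob ?p {A. x \<in> A} = 1 - measure_pmf.prob ?p {A. x \<notin> A}"
    using measure_pmf.prob_compl[of "{A. x \<notin> A}" ?p] by simp
  moreover have "card N > 0"
    using assms card_gt_0_iff by blast
  ultimately show ?thesis
    using prob_random_subset_avoids[OF assms] by (simp add: field_simps)
qed

text \<open>Independence: the event is a product event, with one factor for each index.\<close>
lemma prob_membership_pattern:
  fixes N :: "'a set"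
  assumes "finite N" "x \<in> N" "\<forall>i\<in>{1..T}. a i \<le> card N" "S \<subseteq> {1..T}"
  shows "measure_pmf.prob (random_subsets N T a) {M. {i \<in> {1..T}. x \<in> M i} = S}
           = (\<Prod>i\<in>S. real (a i)) * (\<Prod>i\<in>{1..T} - S. real (card N) - real (a i))
               / real (card N) ^ T"
proof -
  let ?n = "real (card N)"
  let ?p = "\<lambda>i. pmf_of_set {A. A \<subseteq> N \<and> card A = a i}"
  let ?B = "\<lambda>i. if i \<in> S then {A. x \<in> A} else {A. x \<notin> A}"
  have "{M. {i \<in> {1..T}. x \<in> M i} = S} = Pi {1..T} ?B"
    using assms(4) by (auto simp: Pi_iff split: if_splits)
  then have "measure_pmf.prob (random_subsets N T a) {M. {i \<in> {1..T}. x \<in> M i} = S}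
      = (\<Prod>i\<in>{1..T}. measure_pmf.prob (?p i) (?B i))"
    by (simp add: random_subsets_def measure_Pi_pmf_Pi)
  also have "\<dots> = (\<Prod>i\<in>{1..T}. (if i \<in> S then real (a i) else ?n - real (a i)) / ?n)"
    using assms(1-3)
    by (intro prod.cong) (auto simp: prob_random_subset_contains prob_random_subset_avoids)
  also have "\<dots> = (\<Prod>i\<in>{1..T}. if i \<in> S then real (a i) else ?n - real (a i)) / ?n ^ T"
    by (simp add: prod_dividef)
  also have "(\<Prod>i\<in>{1..T}. if i \<in> S then real (a i) else ?n - real (a i))
      = (\<Prod>i\<in>S. real (a i)) * (\<Prod>i\<in>{1..T} - S. ?n - real (a i))"
    using assms(4) by (simp add: prod.If_cases Int_absorb1 Diff_eq)
  finally show ?thesis .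
qed

lemma overlap_count_eq_sum_indicators:
  fixes N :: "'a set"
  assumes "finite N"
  shows "real (overlap_count N T t M)
    = (\<Sum>x\<in>N. \<Sum>S | S \<subseteq> {1..T} \<and> card S = t.
         indicator {M. {i \<in> {1..T}. x \<in> M i} = S} M)"
proof -
  have "(\<Sum>S | S \<subseteq> {1..T} \<and> card S = t. indicator {M. {i \<in> {1..T}. x \<in> M i} = S} M)
      = (if card {i \<in> {1..T}. x \<in> M i} = t then 1 else 0 :: real)" for x
  proof -
    let ?I = "{i \<in> {1..T}. x \<in> M i}"
    have "(\<Sum>S | S \<subseteq> {1..T} \<and> card S = t. indicator {M. {i \<in> {1..T}. x \<in> M i} = S} M)
        = (\<Sum>S | S \<subseteq> {1..T} \<and> card S = t. if ?I = S then 1 else 0 :: real)"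
      by (intro sum.cong) (auto simp: indicator_def)
    also have "\<dots> = (if ?I \<in> {S. S \<subseteq> {1..T} \<and> card S = t} then 1 else 0)"
      by (intro sum.delta') simp
    finally show ?thesis
      by auto
  qed
  then show ?thesis
    using assms by (simp add: overlap_count_def sum.If_cases Int_def)
qed

text \<open>
  The \<open>n\<close> elements contribute equally, which turns the denominator \<open>n\<^bsup>T\<^esup>\<close> into \<open>n\<^bsup>T-1\<^esup>\<close>;
  for \<open>T = 0\<close> and \<open>n > 1\<close> this fails, because \<open>T - 1\<close> is then \<open>0\<close>.
\<close>
lemma expected_overlap_eq:
  fixes N :: "'a set"
  assumes "finite N" "card N \<ge> 1" "T \<ge> 1" "\<forall>i\<in>{1..T}. a i \<le> card N"
  shows "expected_overlap N T a t
    = (\<Sum>S | S \<subseteq> {1..T} \<and> card S = t.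
         (\<Prod>i\<in>S. real (a i)) * (\<Prod>i\<in>{1..T} - S. real (card N) - real (a i))
           / real (card N) ^ (T - 1))"
proof -
  let ?n = "real (card N)"
  let ?P = "\<lambda>S. (\<Prod>i\<in>S. real (a i)) * (\<Prod>i\<in>{1..T} - S. ?n - real (a i))"
  let ?E = "\<lambda>x S. {M. {i \<in> {1..T}. x \<in> M i} = S}"
  have "expected_overlap N T a t
      = (\<Sum>x\<in>N. \<Sum>S | S \<subseteq> {1..T} \<and> card S = t.
           measure_pmf.prob (random_subsets N T a) (?E x S))"
    unfolding expected_overlap_def overlap_count_eq_sum_indicators[OF assms(1)]
    by (simp add: Bochner_Integration.integral_sum integrable_real_indicator
          measure_pmf.emeasure_eq_measure)
  also have "\<dots> = (\<Sum>x\<in>N. \<Sum>S | S \<subseteq> {1..T} \<and> card S = t. ?P S / ?n ^ T)"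
    using assms(1,4) by (intro sum.cong refl prob_membership_pattern) auto
  also have "\<dots> = (\<Sum>S | S \<subseteq> {1..T} \<and> card S = t. ?n * (?P S / ?n ^ T))"
    by (simp add: sum_distrib_left)
  also have "\<dots> = (\<Sum>S | S \<subseteq> {1..T} \<and> card S = t. ?P S / ?n ^ (T - 1))"
  proof (intro sum.cong refl)
    have "?n ^ T = ?n * ?n ^ (T - 1)"
      using assms(3) by (metis Suc_diff_1 less_eq_Suc_le One_nat_def power_Suc)
    moreover have "?n \<noteq> 0"
      using assms(2) by simp
    ultimately show "?n * (?P S / ?n ^ T) = ?P S / ?n ^ (T - 1)" for S
      by simp
  qed
  finally show ?thesis .
qed

corollary expected_full_overlap_eq:
  fixes N :: "'a set"
  assumes "finite N" "card N \<ge> 1" "T \<ge> 1" "\<forall>i\<in>{1..T}. a i \<le> card N"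
  shows "expected_overlap N T a T = (\<Prod>i\<in>{1..T}. real (a i)) / real (card N) ^ (T - 1)"
proof -
  have "S = {1..T}" if "S \<subseteq> {1..T}" "card S = T" for S
    using that by (intro card_subset_eq) auto
  then have "{S. S \<subseteq> {1..T} \<and> card S = T} = {{1..T}}"
    by auto
  then show ?thesis
    using expected_overlap_eq[OF assms, of T] by simp
qed

lemma prod_switched_sizes:
  assumes "\<forall>i\<in>{1..T}. m i \<le> n" "S \<subseteq> {1..T}"
  shows "(\<Prod>i\<in>{1..T}. real (switched_sizes n m S i))
    = (\<Prod>i\<in>S. real (m i)) * (\<Prod>i\<in>{1..T} - S. real n - real (m i))"
proof -
  have "(\<Prod>i\<in>{1..T}. real (switched_sizes n m S i))
      = (\<Prod>i\<in>{1..T}. if i \<in> S then real (m i) else real n - real (m i))"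
    using assms(1) by (intro prod.cong) (auto simp: switched_sizes_def of_nat_diff)
  also have "\<dots> = (\<Prod>i\<in>S. real (m i)) * (\<Prod>i\<in>{1..T} - S. real n - real (m i))"
    using assms(2) by (simp add: prod.If_cases Int_absorb1 Diff_eq)
  finally show ?thesis .
qed

theorem theorem3p1:
  fixes N :: "'a set" and n T t :: nat and m :: "nat \<Rightarrow> nat"
  assumes "finite N" and "card N = n" and "n \<ge> 1" and "T \<ge> 2"
    and "\<forall>i\<in>{1..T}. m i \<le> n" and "t \<le> T"
  shows "expected_overlap N T m t =
           (\<Sum>S | S \<subseteq> {1..T} \<and> card S = t. expected_overlap N T (switched_sizes n m S) T)
       \<and> (\<Sum>S | S \<subseteq> {1..T} \<and> card S = t. expected_overlap N T (switched_sizes n m S) T) =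
           (\<Sum>S | S \<subseteq> {1..T} \<and> card S = t.
              (\<Prod>i\<in>S. real (m i)) * (\<Prod>i\<in>{1..T} - S. real n - real (m i)) / real n ^ (T - 1))
       \<and> (\<forall>m0::nat. (\<forall>i\<in>{1..T}. m i = m0) \<longrightarrow>
            expected_overlap N T m t =
              real (T choose t) * ((real n - real m0) ^ (T - t) * real m0 ^ t / real n ^ (T - 1)))"
proof (intro conjI allI impI)
  let ?\<S> = "{S. S \<subseteq> {1..T} \<and> card S = t}"
  let ?f = "\<lambda>S. (\<Prod>i\<in>S. real (m i)) * (\<Prod>i\<in>{1..T} - S. real n - real (m i))
                  / real n ^ (T - 1)"
  have E: "expected_overlap N T m t = sum ?f ?\<S>"
    using expected_overlap_eq[of N T m t] assms by simp
  have "expected_overlap N T (switched_sizes n m S) T = ?f S" if "S \<in> ?\<S>" for S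
    using expected_full_overlap_eq[of N T "switched_sizes n m S"] prod_switched_sizes[of T m n S]
      that assms by (simp add: switched_sizes_def)
  then show switched: "(\<Sum>S\<in>?\<S>. expected_overlap N T (switched_sizes n m S) T) = sum ?f ?\<S>"
    by (rule sum.cong[OF refl])
  show "expected_overlap N T m t = (\<Sum>S\<in>?\<S>. expected_overlap N T (switched_sizes n m S) T)"
    using E switched by simp
  fix m0
  assume const: "\<forall>i\<in>{1..T}. m i = m0"
  have "?f S = (real n - real m0) ^ (T - t) * real m0 ^ t / real n ^ (T - 1)" if "S \<in> ?\<S>" for S
  proof -
    have "S \<subseteq> {1..T}" "card S = t"
      using that by auto
    then have "(\<Prod>i\<in>S. real (m i)) = real m0 ^ t"
      and "(\<Prod>i\<in>{1..T} - S. real n - real (m i)) = (real n - real m0) ^ (T - t)"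
      using const by (auto simp: subset_iff card_Diff_subset finite_subset[OF _ finite_atLeastAtMost])
    then show ?thesis
      by (simp add: mult.commute)
  qed
  then have "sum ?f ?\<S>
      = (\<Sum>S\<in>?\<S>. (real n - real m0) ^ (T - t) * real m0 ^ t / real n ^ (T - 1))"
    by (rule sum.cong[OF refl])
  moreover have "card ?\<S> = T choose t"
    by (simp add: n_subsets)
  ultimately show "expected_overlap N T m t =
      real (T choose t) * ((real n - real m0) ^ (T - t) * real m0 ^ t / real n ^ (T - 1))"
    unfolding E by (simp only: sum_constant)
qed

end
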